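(* Let $p_{C_0}(z,w)=\left(-z(w^2-4w+1)+w^2+4w+1\right)^2$. Then $$2\pi\,\mathrm{m}(p_{C_0})=16\,D\!\left((2+\sqrt3)i\right)+\frac{8\pi}{3}\log(2+\sqrt3),$$ and in particular $20\,v_{\mathrm{tet}}<2\pi\,\mathrm{m}(p_{C_0})$.
   Context: Mahler measure: $\mathrm{m}(P)=\frac{1}{(2\pi i)^2}\int_{|z|=|w|=1}\log|P(z,w)|\frac{dz}{z}\frac{dw}{w}$. $D$ is the Bloch–Wigner dilogarithm $D(z)=\operatorname{Im}(\mathrm{Li}_2(z))+\arg(1-z)\log|z|$, $\mathrm{Li}_2(z)=-\int_0^z\frac{\log(1-t)}{t}dt$. $v_{\mathrm{tet}}=D(e^{i\pi/3})\approx1.01494$. *)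

theory Defs
  imports "HOL-Complex_Analysis.Complex_Analysis"
begin

definition mahler2 :: "(complex \<Rightarrow> complex \<Rightarrow> complex) \<Rightarrow> real" where
  "mahler2 P = (1 / (4 * pi\<^sup>2)) *
     (LINT st : ({0..2*pi} \<times> {0..2*pi}) | lborel. ln (cmod (P (cis (fst st)) (cis (snd st)))))"

definition Li2 :: "complex \<Rightarrow> complex" where
  "Li2 z = - contour_integral (linepath 0 z) (\<lambda>t. Ln (1 - t) / t)"

definition BlochWigner :: "complex \<Rightarrow> real" where
  "BlochWigner z = Im (Li2 z) + Arg (1 - z) * ln (cmod z)"

definition v_tet :: real where
  "v_tet = BlochWigner (cis (pi / 3))"

definition p_C0 :: "complex \<Rightarrow> complex \<Rightarrow> complex" where
  "p_C0 z w = (- z * (w\<^sup>2 - 4 * w + 1) + w\<^sup>2 + 4 * w + 1)\<^sup>2"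

end

theory Submission
  imports Defs
begin

text \<open>
  On the torus, \<open>z = cis s\<close> and \<open>w = cis t\<close> give
  \<open>\<bar>p\<bar> = \<bar>(4 - 2 cos t) z + (4 + 2 cos t)\<bar>\<^sup>2\<close>, so Jensen's formula in \<open>z\<close> reduces
  \<open>2 \<pi> m(p)\<close> to \<open>8 \<integral> ln (4 + 2 cos t) dt\<close> over \<open>[0, \<pi>/2]\<close>. If \<open>y + 1/y = 4\<close>, that is
  \<open>y = 2 \<plusminus> \<surd>3\<close>, then \<open>y (4 + 2 cos t) = 1 + 2 y cos t + y\<^sup>2\<close>, whose logarithm integrates over
  \<open>[0, \<pi>/2]\<close> to \<open>2 Im Li\<^sub>2(iy)\<close>. The root \<open>2 + \<surd>3\<close> gives the closed formula directly,
  without the inversion formula for the dilogarithm; the root \<open>2 - \<surd>3\<close> gives the lower bound,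
  since there \<open>Li\<^sub>2\<close> is evaluated near 0.
\<close>


section \<open>Jensen's formula for linear polynomials, and iterated integration\<close>

text \<open>Mean value property: \<open>1 + u * z\<close> has positive real part on the closed unit
  disc, so \<open>Ln (1 + u * z)\<close> is holomorphic inside and continuous up to the boundary.
  Cauchy's formula at the centre, where it vanishes, gives the claim after taking real
  parts.\<close>

lemma has_integral_ln_cmod_one_plus_cis:
  fixes u :: complex
  assumes "cmod u < 1"
  shows "((\<lambda>s. ln (cmod (1 + u * cis s))) has_integral 0) {0..2*pi}"
proof -
  define f where "f = (\<lambda>z. Ln (1 + u * z))"
  have pos: "1 + u * z \<notin> \<real>\<^sub>\<le>\<^sub>0" if "cmod z \<le> 1" for z
  proof -
    have "cmod (u * z) < 1"
      using assms that by (metis mult_left_le norm_ge_zero norm_mult order_le_less_trans)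
    then have "Re (1 + u * z) > 0"
      using abs_Re_le_cmod[of "u * z"] by simp
    then show ?thesis
      using complex_nonpos_Reals_iff by (metis not_less)
  qed
  have holo: "f holomorphic_on ball 0 1"
    unfolding f_def by (intro holomorphic_intros pos) auto
  have cont: "continuous_on (cball 0 1) f"
    unfolding f_def by (intro continuous_intros pos) auto
  have "((\<lambda>z. f z / (z - 0)) has_contour_integral (2 * of_real pi * \<i> * f 0)) (circlepath 0 1)"
    by (rule Cauchy_integral_circlepath[OF cont holo]) auto
  then have "((\<lambda>z. f z / z) has_contour_integral 0) (part_circlepath 0 1 0 (2*pi))"
    by (simp add: f_def circlepath_def)
  then have "((\<lambda>s. f (cis s) * \<i>) has_integral 0) {0..2*pi}"
    by (subst (asm) has_contour_integral_part_circlepath_iff) (auto simp: cis_neq_zero)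
  from has_integral_Im[OF this]
  have "((\<lambda>s. Re (f (cis s))) has_integral 0) {0..2*pi}"
    by simp
  moreover have "Re (f (cis s)) = ln (cmod (1 + u * cis s))" for s
    unfolding f_def using pos[of "cis s"] by (subst Re_Ln) auto
  ultimately show ?thesis
    by simp
qed

lemma has_integral_ln_cmod_linear_cis_less:
  fixes a b :: complex
  assumes "cmod a < cmod b"
  shows "((\<lambda>s. ln (cmod (a * cis s + b))) has_integral 2 * pi * ln (cmod b)) {0..2*pi}"
proof -
  have b: "b \<noteq> 0" using assms by auto
  have u: "cmod (a / b) < 1"
    using assms b by (simp add: norm_divide)
  have "((\<lambda>s. ln (cmod (1 + a / b * cis s)) + ln (cmod b)) has_integral
          0 + 2 * pi * ln (cmod b)) {0..2*pi}"
    using has_integral_const_real[of "ln (cmod b)" 0 "2*pi"]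
    by (intro has_integral_add has_integral_ln_cmod_one_plus_cis u) simp
  moreover have "ln (cmod (1 + a / b * cis s)) + ln (cmod b) = ln (cmod (a * cis s + b))" for s
  proof -
    have "cmod (a / b * cis s) < 1"
      using u by (simp only: norm_mult norm_cis mult_1_right)
    then have "1 + a / b * cis s \<noteq> 0"
      by (metis add.inverse_inverse add_eq_0_iff less_irrefl norm_minus_cancel norm_one)
    then have "ln (cmod (1 + a / b * cis s)) + ln (cmod b) = ln (cmod ((1 + a / b * cis s) * b))"
      using b by (simp add: ln_mult_pos norm_mult)
    also have "(1 + a / b * cis s) * b = a * cis s + b"
      using b by (simp add: field_simps)
    finally show ?thesis .
  qed
  ultimately show ?thesis
    by simp
qed

text \<open>Jensen's formula in degree one. When \<open>a\<close> dominates, conjugation followed by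
  multiplication by the unimodular \<open>cis s\<close> exchanges the roles of the
  coefficients.\<close>

lemma has_integral_ln_cmod_linear_cis:
  fixes a b :: complex
  assumes "cmod a \<noteq> cmod b"
  shows "((\<lambda>s. ln (cmod (a * cis s + b))) has_integral 2 * pi * ln (max (cmod a) (cmod b))) {0..2*pi}"
proof (cases "cmod a < cmod b")
  case True
  then show ?thesis
    using has_integral_ln_cmod_linear_cis_less[OF True] by (simp add: max_def)
next
  case False
  then have "cmod (cnj b) < cmod (cnj a)"
    using assms by simp
  from has_integral_ln_cmod_linear_cis_less[OF this]
  have "((\<lambda>s. ln (cmod (cnj b * cis s + cnj a))) has_integral 2 * pi * ln (cmod a)) {0..2*pi}"
    by simp
  moreover have "cmod (cnj b * cis s + cnj a) = cmod (a * cis s + b)" for s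
  proof -
    have "cmod (cnj b * cis s + cnj a) = cmod (cnj (cnj b * cis s + cnj a) * cis s)"
      by (simp only: norm_mult complex_mod_cnj norm_cis mult_1_right)
    also have "cnj (cnj b * cis s + cnj a) * cis s = a * cis s + b * (cnj (cis s) * cis s)"
      by (simp add: algebra_simps)
    also have "cnj (cis s) * cis s = 1"
      by (simp add: cis_cnj cis_mult)
    finally show ?thesis
      by simp
  qed
  ultimately show ?thesis
    using False assms by (simp add: max_def)
qed

text \<open>
  Integrability on the product is part of the claim: a Bochner integral of a non-integrable
  function would be 0. It follows from the upper bound, as \<open>C - f\<close> is nonnegative.
\<close>

lemma set_lebesgue_integral_Times_iterated:
  fixes f :: "real \<times> real \<Rightarrow> real" and C :: real
  assumes meas [measurable]: "f \<in> borel_measurable borel" "A \<in> sets lborel" "B \<in> sets lborel"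
    and fin: "emeasure lborel A < \<infinity>" "emeasure lborel B < \<infinity>"
    and bound: "\<And>s t. s \<in> A \<Longrightarrow> t \<in> B \<Longrightarrow> f (s, t) \<le> C"
    and inner: "AE t in lborel. t \<in> B \<longrightarrow>
        set_integrable lborel A (\<lambda>s. f (s, t)) \<and> (LINT s:A|lborel. f (s, t)) = g t"
    and outer: "set_integrable lborel B g"
  shows "(LINT x : (A \<times> B) | lborel. f x) = (LINT t:B|lborel. g t)"
proof -
  \<comment> \<open>The variables are swapped so that the inner integral of Fubini's criterion runs
    over \<open>s\<close>, where \<open>inner\<close> applies.\<close>
  define h where "h = (\<lambda>(t, s). indicator B t * (indicator A s * (C - f (s, t))))"
  define k where "k = (\<lambda>(t, s). indicator B t * (indicator A s * C))"
  have fm [measurable]: "f \<in> borel_measurable (lborel \<Otimes>\<^sub>M lborel)"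
    using meas(1) unfolding lborel_prod by simp
  have hm: "h \<in> borel_measurable (lborel \<Otimes>\<^sub>M lborel)"
    unfolding h_def by measurable
  have h_nonneg: "h (t, s) \<ge> 0" for t s
    using bound by (auto simp: h_def indicator_def)
  have constA: "set_integrable lborel A (\<lambda>s. C)" and constB: "set_integrable lborel B (\<lambda>s. r)" for r :: real
    using fin meas by (auto simp: set_integrable_def)
  \<comment> \<open>As \<open>h\<close> is nonnegative, the integral of its norm is that of
    \<open>h\<close> itself, which \<open>inner\<close> evaluates.\<close>
  have inner_h: "AE t in lborel. integrable lborel (\<lambda>s. h (t, s)) \<and>
      (LINT s|lborel. norm (h (t, s))) =
        indicator B t * ((LINT s:A|lborel. C) - g t)"
    using inner
  proof eventually_elim
    case (elim t)
    show ?case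
    proof (cases "t \<in> B")
      case True
      with elim have "set_integrable lborel A (\<lambda>s. C - f (s, t))"
        "(LINT s:A|lborel. C - f (s, t)) = (LINT s:A|lborel. C) - g t"
        using constA True by (auto simp: set_integral_diff)
      with True show ?thesis
        using h_nonneg[of t] by (simp add: h_def set_integrable_def set_lebesgue_integral_def)
    qed (simp add: h_def)
  qed
  have "integrable (lborel \<Otimes>\<^sub>M lborel) h"
  proof (rule lborel_pair.Fubini_integrable[OF hm])
    have "set_integrable lborel B (\<lambda>t. (LINT s:A|lborel. C) - g t)"
      using set_integral_diff(1)[OF constB outer] by blast
    then have "integrable lborel (\<lambda>t. indicator B t * ((LINT s:A|lborel. C) - g t))"
      by (simp add: set_integrable_def)
    then show "integrable lborel (\<lambda>t. LINT s|lborel. norm (h (t, s)))"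
      using inner_h hm by (subst integrable_cong_AE) auto
    show "AE t in lborel. integrable lborel (\<lambda>s. h (t, s))"
      using inner_h by eventually_elim simp
  qed
  moreover have "integrable (lborel \<Otimes>\<^sub>M lborel) k"
  proof -
    have "B \<times> A \<in> sets (lborel \<Otimes>\<^sub>M lborel)"
      using meas(2,3) by (intro pair_measureI)
    moreover have "emeasure (lborel \<Otimes>\<^sub>M lborel) (B \<times> A) < \<infinity>"
      using fin meas(2,3) by (simp add: lborel.emeasure_pair_measure_Times ennreal_mult_less_top)
    ultimately have "integrable (lborel \<Otimes>\<^sub>M lborel) (\<lambda>x. indicator (B \<times> A) x *\<^sub>R C)"
      by (intro integrable_scaleR_left integrable_real_indicator)
    also have "(\<lambda>x. indicator (B \<times> A) x *\<^sub>R C) = k"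
      by (auto simp: k_def indicator_def fun_eq_iff)
    finally show ?thesis .
  qed
  ultimately have "integrable (lborel \<Otimes>\<^sub>M lborel) (\<lambda>x. k x - h x)"
    by (intro Bochner_Integration.integrable_diff)
  also have "(\<lambda>x. k x - h x) = (\<lambda>(t, s). (indicator (A \<times> B) (s, t) * f (s, t)))"
    by (auto simp: k_def h_def indicator_def fun_eq_iff)
  finally have int: "integrable (lborel \<Otimes>\<^sub>M lborel) (\<lambda>(t, s). indicator (A \<times> B) (s, t) * f (s, t))" .
  then have int': "integrable (lborel \<Otimes>\<^sub>M lborel) (case_prod (\<lambda>s t. indicator (A \<times> B) (s, t) * f (s, t)))"
    using lborel_pair.integrable_product_swap[OF int] by (simp add: case_prod_unfold)
  have "(LINT x : (A \<times> B) | lborel. f x) =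
      (LINT x|(lborel \<Otimes>\<^sub>M lborel). (case_prod (\<lambda>s t. indicator (A \<times> B) (s, t) * f (s, t))) x)"
    by (simp add: set_lebesgue_integral_def lborel_prod case_prod_unfold)
  also have "\<dots> = (LINT t|lborel. LINT s|lborel. indicator (A \<times> B) (s, t) * f (s, t))"
    using lborel_pair.integral_snd[OF int'] by (simp add: case_prod_unfold)
  also have "\<dots> = (LINT t:B|lborel. g t)"
    unfolding set_lebesgue_integral_def
  proof (rule integral_cong_AE)
    show "(\<lambda>t. LINT s|lborel. indicator (A \<times> B) (s, t) * f (s, t)) \<in> borel_measurable lborel"
      using lborel_pair.integrable_snd[OF int'] by simp
    show "(\<lambda>t. indicat_real B t *\<^sub>R g t) \<in> borel_measurable lborel"
      using outer by (simp add: set_integrable_def)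
    show "AE t in lborel. (LINT s|lborel. indicator (A \<times> B) (s, t) * f (s, t)) = indicat_real B t *\<^sub>R g t"
      using inner
      by eventually_elim (auto simp: set_lebesgue_integral_def indicator_times indicator_def)
  qed
  finally show ?thesis .
qed


section \<open>The dilogarithm along a ray from the origin\<close>

text \<open>The condition on \<open>1 - z\<close> keeps \<open>z\<close> off the cut from 1 to
  infinity, hence also the whole segment from 0 to \<open>z\<close>. Existence of the integral has
  to be proved, since \<open>contour_integral\<close> says nothing useful otherwise.\<close>

lemma has_integral_Li2:
  assumes z: "1 - z \<notin> \<real>\<^sub>\<le>\<^sub>0" "z \<noteq> 0"
  shows "((\<lambda>s. - (Ln (1 - of_real s * z) / of_real s)) has_integral Li2 z) {0..1}"
proof -
  define S where "S = {t :: complex. 1 - t \<notin> \<real>\<^sub>\<le>\<^sub>0}"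
  \<comment> \<open>\<open>F\<close> removes the singularity of \<open>Ln (1 - t) / t\<close> at 0;
    the trivial terms \<open>Ln (1 - 0)\<close> and \<open>t - 0\<close> match the shape of
    \<open>pole_lemma\<close>.\<close>
  define F where "F = (\<lambda>t. if t = 0 then deriv (\<lambda>t. Ln (1 - t)) 0 else (Ln (1 - t) - Ln (1 - 0)) / (t - 0))"
  have S_vimage: "S = (\<lambda>t. 1 - t) -` (- \<real>\<^sub>\<le>\<^sub>0)"
    by (auto simp: S_def)
  have "open S"
    unfolding S_vimage by (intro continuous_open_vimage open_Compl closed_nonpos_Reals_complex) auto
  moreover have "0 \<in> S"
    by (auto simp: S_def complex_nonpos_Reals_iff)
  ultimately have F: "F holomorphic_on S"
    unfolding F_def
    by (intro pole_lemma) (auto simp: S_def interior_open intro!: holomorphic_intros)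
  have seg: "of_real s * z \<in> S" if "s \<in> {0..1}" for s
  proof (rule ccontr)
    assume "of_real s * z \<notin> S"
    then have im: "s * Im z = 0" and re: "1 \<le> s * Re z"
      by (auto simp: S_def complex_nonpos_Reals_iff)
    from re have "s \<noteq> 0" by auto
    with im have "Im z = 0" by simp
    moreover have "Re z \<ge> 1"
      using re that mult_left_le_one_le[of "Re z" s] by (smt (verit) atLeastAtMost_iff mult_nonneg_nonpos)
    ultimately show False
      using z by (auto simp: complex_nonpos_Reals_iff)
  qed
  have "continuous_on {0..1} (\<lambda>s. F (of_real s * z) * z)"
    using seg by (intro continuous_intros continuous_on_compose2[OF holomorphic_on_imp_continuous_on[OF F]]) auto
  then obtain I where "((\<lambda>s. F (of_real s * z) * z) has_integral I) {0..1}"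
    using integrable_continuous_real by blast
  then have I: "((\<lambda>s. Ln (1 - of_real s * z) / (of_real s * z) * z) has_integral I) {0..1}"
    by (rule has_integral_spike_finite[of "{0}", rotated 2]) (use z in \<open>auto simp: F_def\<close>)
  then have "contour_integral (linepath 0 z) (\<lambda>t. Ln (1 - t) / t) = I"
    by (intro contour_integral_unique, unfold has_contour_integral_linepath)
      (simp add: linepath_def scaleR_conv_of_real)
  then have "Li2 z = - I"
    by (simp add: Li2_def)
  then show ?thesis
    using has_integral_neg[OF I] z by simp
qed

text \<open>For \<open>Re z < 1\<close> the points \<open>1 - s * z\<close> stay in the right
  half-plane, where the imaginary part of \<open>Ln\<close> is a plain
  \<open>arctan\<close>.\<close>

lemma has_integral_Im_Li2:
  assumes z: "Re z < 1" "z \<noteq> 0"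
  shows "((\<lambda>s. arctan (s * Im z / (1 - s * Re z)) / s) has_integral Im (Li2 z)) {0..1}"
proof -
  have "1 - z \<notin> \<real>\<^sub>\<le>\<^sub>0"
    using z by (auto simp: complex_nonpos_Reals_iff)
  from has_integral_Im[OF has_integral_Li2[OF this z(2)]]
  have *: "((\<lambda>s. Im (- (Ln (1 - of_real s * z) / of_real s))) has_integral Im (Li2 z)) {0..1}" .
  show ?thesis
  proof (rule has_integral_eq[OF _ *])
    fix s :: real assume s: "s \<in> {0..1}"
    have "Re (1 - of_real s * z) > 0"
    proof -
      have "s * Re z < 1"
      proof (cases "Re z \<le> 0")
        case True
        then show ?thesis using s by (smt (verit) atLeastAtMost_iff mult_nonneg_nonpos)
      next
        case False
        then show ?thesis using s z by (smt (verit) atLeastAtMost_iff mult_left_le_one_le)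
      qed
      then show ?thesis by simp
    qed
    moreover from this have "1 - of_real s * z \<noteq> 0"
      by (metis less_irrefl zero_complex.sel(1))
    ultimately have "Im (Ln (1 - of_real s * z)) = - arctan (s * Im z / (1 - s * Re z))"
      by (simp flip: Arg_eq_Im_Ln add: arg_conv_arctan arctan_minus)
    then show "Im (- (Ln (1 - of_real s * z) / of_real s)) = arctan (s * Im z / (1 - s * Re z)) / s"
      by simp
  qed
qed

section \<open>Logarithmic cosine integrals over a quarter period\<close>

lemma has_integral_ln_cos_kernel:
  assumes y: "y > 0"
  shows "((\<lambda>t. 2 * (y + cos t) / (1 + 2 * y * cos t + y\<^sup>2)) has_integral 2 * arctan y / y) {0..pi/2}"
proof -
  \<comment> \<open>Antiderivative from the substitution \<open>tan (t / 2)\<close>, which is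
    regular on the whole interval.\<close>
  define G where "G = (\<lambda>t. (t + 2 * arctan ((y - 1) / (y + 1) * tan (t / 2))) / y)"
  have "((\<lambda>t. 2 * (y + cos t) / (1 + 2 * y * cos t + y\<^sup>2)) has_integral (G (pi/2) - G 0)) {0..pi/2}"
  proof (rule fundamental_theorem_of_calculus)
    fix t assume t: "t \<in> {0..pi/2}"
    define c where "c = cos (t / 2)"
    have c: "c > 0"
    proof -
      have "- (pi / 2) < t / 2" "t / 2 < pi / 2"
        using t pi_gt_zero unfolding atLeastAtMost_iff by linarith+
      then show ?thesis
        unfolding c_def by (rule cos_gt_zero_pi)
    qed
    have ct: "cos t = 2 * c\<^sup>2 - 1"
      using cos_double_cos[of "t/2"] by (simp add: c_def)
    have "cos t \<ge> 0"
      using t by (intro cos_ge_zero) auto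
    then have den: "1 + 2 * y * cos t + y\<^sup>2 > 0"
      using y by (smt (verit) mult_nonneg_nonneg zero_le_power2)
    have tn: "(tan (t/2))\<^sup>2 = (1 - c\<^sup>2) / c\<^sup>2"
      using c by (simp add: tan_def c_def power_divide sin_squared_eq)
    define D where "D = inverse (c\<^sup>2) / 2"
    have D: "((\<lambda>t. tan (t / 2)) has_field_derivative D) (at t within {0..pi/2})"
      using c unfolding D_def c_def by (auto intro!: derivative_eq_intros)
    have "(G has_field_derivative
        (1 + 2 * (inverse (1 + ((y - 1) / (y + 1) * tan (t / 2))\<^sup>2) * ((y - 1) / (y + 1) * D))) / y)
        (at t within {0..pi/2})"
      unfolding G_def by (intro DERIV_cdivide DERIV_add DERIV_ident DERIV_cmult D DERIV_chain2[OF DERIV_arctan])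
    also have "(1 + 2 * (inverse (1 + ((y - 1) / (y + 1) * tan (t / 2))\<^sup>2) * ((y - 1) / (y + 1) * D))) / y
        = 2 * (y + cos t) / (1 + 2 * y * cos t + y\<^sup>2)"
    proof -
      have "((y - 1) / (y + 1) * tan (t / 2))\<^sup>2 = (y - 1)\<^sup>2 * (1 - c\<^sup>2) / ((y + 1)\<^sup>2 * c\<^sup>2)"
        by (simp add: power_mult_distrib power_divide tn)
      then have "1 + ((y - 1) / (y + 1) * tan (t / 2))\<^sup>2 =
          ((y + 1)\<^sup>2 * c\<^sup>2 + (y - 1)\<^sup>2 * (1 - c\<^sup>2)) / ((y + 1)\<^sup>2 * c\<^sup>2)"
        using y c by (simp add: add_divide_distrib)
      also have "(y + 1)\<^sup>2 * c\<^sup>2 + (y - 1)\<^sup>2 * (1 - c\<^sup>2) = 1 + 2 * y * cos t + y\<^sup>2"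
        by (simp add: ct algebra_simps power2_eq_square)
      finally have "1 + ((y - 1) / (y + 1) * tan (t / 2))\<^sup>2 = (1 + 2 * y * cos t + y\<^sup>2) / ((y + 1)\<^sup>2 * c\<^sup>2)" .
      moreover have "2 * (inverse (P / (r\<^sup>2 * k)) * (m / r * (inverse k / 2))) = m * r / P"
        if "P > 0" "r > 0" "k > 0" for P r k m :: real
        using that by (simp add: field_simps power2_eq_square)
      ultimately have "2 * (inverse (1 + ((y - 1) / (y + 1) * tan (t / 2))\<^sup>2) * ((y - 1) / (y + 1) * D))
         = (y - 1) * (y + 1) / (1 + 2 * y * cos t + y\<^sup>2)"
        using den c y unfolding D_def by (metis add_pos_pos zero_less_one zero_less_power)
      then show ?thesis
        using y den by (simp add: field_simps power2_eq_square)
    qed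
    finally show "(G has_vector_derivative 2 * (y + cos t) / (1 + 2 * y * cos t + y\<^sup>2)) (at t within {0..pi/2})"
      by (simp add: has_real_derivative_iff_has_vector_derivative)
  qed auto
  moreover have "G (pi/2) - G 0 = 2 * arctan y / y"
  proof -
    \<comment> \<open>Tangent subtraction formula with \<open>tan (pi / 4) = 1\<close>; twice
      \<open>arctan 1\<close> then cancels the \<open>pi / 2\<close> in
      \<open>G (pi/2)\<close>.\<close>
    have "arctan ((y - 1) / (y + 1)) = arctan y - arctan 1"
    proof (rule arctan_unique)
      show b: "- (pi / 2) < arctan y - arctan 1" "arctan y - arctan 1 < pi / 2"
        using y arctan_ubound[of y] zero_less_arctan_iff[of y] pi_gt_zero unfolding arctan_one by linarith+
      have "tan (arctan y - arctan 1) = (tan (arctan y) - tan (arctan 1)) / (1 + tan (arctan y) * tan (arctan 1))"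
        using cos_gt_zero_pi[OF b] by (intro tan_diff cos_arctan_not_zero) simp
      then show "tan (arctan y - arctan 1) = (y - 1) / (y + 1)"
        by (simp add: tan_arctan arctan_one tan_45 add.commute)
    qed
    then show ?thesis
      using y by (simp add: G_def tan_45 arctan_one field_simps)
  qed
  ultimately show ?thesis by simp
qed


text \<open>
  Differentiate under the integral sign in the scaling \<open>y \<rightarrow> s y\<close>: the kernel \<open>K\<close> below is the
  \<open>s\<close>-derivative of the integrand, and its \<open>t\<close>-integral is the integrand of \<open>2 Im Li\<^sub>2(iy)\<close>.
\<close>

lemma has_integral_ln_cos:
  assumes y: "y > 0"
  shows "((\<lambda>t. ln (1 + 2 * y * cos t + y\<^sup>2)) has_integral 2 * Im (Li2 (of_real y * \<i>))) {0..pi/2}"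
proof -
  define K where "K = (\<lambda>s t. 2 * y * (s * y + cos t) / (1 + 2 * (s * y) * cos t + (s * y)\<^sup>2))"
  have den: "1 + 2 * (s * y) * cos t + (s * y)\<^sup>2 > 0" if "s \<ge> 0" "t \<in> {0..pi/2}" for s t
  proof -
    have "cos t \<ge> 0"
      using that by (intro cos_ge_zero) auto
    then have "0 \<le> 2 * (s * y) * cos t"
      using that y by simp
    then show ?thesis
      by (smt (verit) zero_le_power2)
  qed
  have "continuous_on (cbox (0, 0) (1, pi/2)) (\<lambda>(s, t). K s t)"
    unfolding K_def case_prod_unfold
  proof (intro continuous_intros ballI)
    fix x :: "real \<times> real" assume "x \<in> cbox (0, 0) (1, pi/2)"
    then have "fst x \<ge> 0" "snd x \<in> {0..pi/2}"
      by (auto simp: cbox_Pair_eq)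
    from den[OF this] show "1 + 2 * (fst x * y) * cos (snd x) + (fst x * y)\<^sup>2 \<noteq> 0"
      by simp
  qed
  note swap = integral_swap_continuous[OF this, unfolded cbox_interval]
  have in_s: "((\<lambda>s. K s t) has_integral ln (1 + 2 * y * cos t + y\<^sup>2)) {0..1}" if t: "t \<in> {0..pi/2}" for t
  proof -
    have "((\<lambda>s. K s t) has_integral (ln (1 + 2 * (1 * y) * cos t + (1 * y)\<^sup>2) - ln (1 + 2 * (0 * y) * cos t + (0 * y)\<^sup>2))) {0..1}"
    proof (rule fundamental_theorem_of_calculus)
      fix s :: real assume "s \<in> {0..1}"
      then have "((\<lambda>s. ln (1 + 2 * (s * y) * cos t + (s * y)\<^sup>2)) has_field_derivative K s t) (at s within {0..1})"
        unfolding K_def using den[of s t] t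
        by (auto intro!: derivative_eq_intros simp: field_simps power2_eq_square)
      then show "((\<lambda>s. ln (1 + 2 * (s * y) * cos t + (s * y)\<^sup>2)) has_vector_derivative K s t) (at s within {0..1})"
        by (simp add: has_real_derivative_iff_has_vector_derivative)
    qed auto
    then show ?thesis by simp
  qed
  have in_t: "integral {0..pi/2} (K s) = 2 * (arctan (s * y) / s)" if "s > 0" for s
  proof -
    have "((\<lambda>t. y * (2 * (s * y + cos t) / (1 + 2 * (s * y) * cos t + (s * y)\<^sup>2))) has_integral
        y * (2 * arctan (s * y) / (s * y))) {0..pi/2}"
      using that y by (intro has_integral_mult_right has_integral_ln_cos_kernel) simp
    moreover have "y * (2 * (s * y + cos t) / (1 + 2 * (s * y) * cos t + (s * y)\<^sup>2)) = K s t" for t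
      by (simp add: K_def)
    ultimately have "(K s has_integral y * (2 * arctan (s * y) / (s * y))) {0..pi/2}"
      by simp
    then show ?thesis
      using y that by (subst integral_unique) auto
  qed
  have "((\<lambda>s. 2 * (arctan (s * y) / s)) has_integral 2 * Im (Li2 (of_real y * \<i>))) {0..1}"
    using has_integral_Im_Li2[of "of_real y * \<i>"] y by (intro has_integral_mult_right) simp
  \<comment> \<open>Only \<open>s = 0\<close> is exceptional: there
    \<open>arctan (s * y) / s\<close> is 0 by division by zero, while the integral of
    \<open>K 0\<close> is \<open>2 * y\<close>.\<close>
  then have "((\<lambda>s. integral {0..pi/2} (K s)) has_integral 2 * Im (Li2 (of_real y * \<i>))) {0..1}"
    by (rule has_integral_spike_finite[of "{0}", rotated 2]) (auto simp: in_t)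
  then have "2 * Im (Li2 (of_real y * \<i>)) = integral {0..pi/2} (\<lambda>t. integral {0..1} (\<lambda>s. K s t))"
    using swap by (simp add: integral_unique)
  also have "\<dots> = integral {0..pi/2} (\<lambda>t. ln (1 + 2 * y * cos t + y\<^sup>2))"
    by (intro Henstock_Kurzweil_Integration.integral_cong integral_unique in_s)
  finally have eq: "integral {0..pi/2} (\<lambda>t. ln (1 + 2 * y * cos t + y\<^sup>2)) = 2 * Im (Li2 (of_real y * \<i>))" ..
  have "(\<lambda>t. ln (1 + 2 * y * cos t + y\<^sup>2)) integrable_on {0..pi/2}"
    using den[of 1] by (intro integrable_continuous_real continuous_intros) force+
  then show ?thesis
    unfolding eq[symmetric] by (rule integrable_integral)
qed

lemma has_integral_ln_four_plus_cos:
  assumes y: "y > 0" "1 + y\<^sup>2 = 4 * y"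
  shows "((\<lambda>t. ln (4 + 2 * cos t)) has_integral 2 * Im (Li2 (of_real y * \<i>)) - pi / 2 * ln y) {0..pi/2}"
proof -
  have "((\<lambda>t. ln (1 + 2 * y * cos t + y\<^sup>2) - ln y) has_integral
      2 * Im (Li2 (of_real y * \<i>)) - pi / 2 * ln y) {0..pi/2}"
    using has_integral_const_real[of "ln y" 0 "pi/2"]
    by (intro has_integral_diff has_integral_ln_cos y) simp
  moreover have "ln (1 + 2 * y * cos t + y\<^sup>2) - ln y = ln (4 + 2 * cos t)" for t
  proof -
    have "1 + 2 * y * cos t + y\<^sup>2 = y * (4 + 2 * cos t)"
      using y by (simp add: algebra_simps)
    moreover have "4 + 2 * cos t > 0"
      using cos_ge_minus_one[of t] by linarith
    ultimately show ?thesis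
      using y by (simp add: ln_mult_pos)
  qed
  ultimately show ?thesis by simp
qed

text \<open>Reflection in \<open>pi / 2\<close> and translation by \<open>pi\<close> preserve the
  absolute value of the cosine. This carries the quarter-period integral to the full circle, where
  Jensen's formula produces that absolute value.\<close>

lemma has_integral_abs_cos_period:
  fixes g :: "real \<Rightarrow> real"
  assumes "((\<lambda>t. g (cos t)) has_integral I) {0..pi/2}"
  shows "((\<lambda>t. g \<bar>cos t\<bar>) has_integral 4 * I) {0..2*pi}"
proof -
  have 1: "((\<lambda>t. g \<bar>cos t\<bar>) has_integral I) {0..pi/2}"
    by (rule has_integral_eq[OF _ assms]) (simp add: cos_ge_zero)
  have "((\<lambda>t. g \<bar>cos (- 1 * t + pi)\<bar>) has_integral I) {pi/2..pi}"
    using has_integral_affinity[of "\<lambda>t. g \<bar>cos t\<bar>" I 0 "pi/2" "-1" pi] 1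
    by (simp add: image_affinity_atLeastAtMost)
  then have 2: "((\<lambda>t. g \<bar>cos t\<bar>) has_integral I) {pi/2..pi}"
    by (simp add: cos_diff)
  have 12: "((\<lambda>t. g \<bar>cos t\<bar>) has_integral I + I) {0..pi}"
    by (rule has_integral_combine[OF _ _ 1 2]) auto
  have "((\<lambda>t. g \<bar>cos (1 * t + - pi)\<bar>) has_integral I + I) {pi..2*pi}"
    using has_integral_affinity[of "\<lambda>t. g \<bar>cos t\<bar>" "I + I" 0 pi 1 "-pi"] 12
    by (simp add: image_affinity_atLeastAtMost)
  then have 3: "((\<lambda>t. g \<bar>cos t\<bar>) has_integral I + I) {pi..2*pi}"
    by (simp add: cos_diff)
  have "((\<lambda>t. g \<bar>cos t\<bar>) has_integral (I + I) + (I + I)) {0..2*pi}"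
    by (rule has_integral_combine[OF _ _ 12 3]) auto
  then show ?thesis by simp
qed

section \<open>A special angle and numerical bounds\<close>

text \<open>The angle splits as \<open>pi / 4 + pi / 6\<close>. It supplies the argument term of the
  Bloch-Wigner function at \<open>(2 + sqrt 3) * \<i>\<close>.\<close>

lemma arctan_two_plus_sqrt3: "arctan (2 + sqrt 3) = 5 * pi / 12"
proof (rule arctan_unique)
  show "- (pi / 2) < 5 * pi / 12" "5 * pi / 12 < pi / 2"
    using pi_gt_zero by linarith+
  have "sqrt 3 > 1" "sqrt 3 < 3"
    by (auto intro: real_less_lsqrt)
  have "tan (5 * pi / 12) = tan (pi / 4 + pi / 6)"
    by (simp add: field_simps)
  also have "\<dots> = (1 + 1 / sqrt 3) / (1 - 1 / sqrt 3)"
  proof -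
    have "cos (pi / 4 + pi / 6) \<noteq> 0"
      using cos_gt_zero_pi[of "pi / 4 + pi / 6"] pi_gt_zero by linarith
    then show ?thesis
      by (subst tan_add) (auto simp: tan_45 tan_30 cos_45 cos_30)
  qed
  also have "\<dots> = 2 + sqrt 3"
    using \<open>sqrt 3 > 1\<close> \<open>sqrt 3 < 3\<close> by (simp add: field_simps)
  finally show "tan (5 * pi / 12) = 2 + sqrt 3" .
qed

lemma ln_two_plus_sqrt3_gt: "ln (2 + sqrt 3) > 1.31"
proof -
  have s: "sqrt 3 \<ge> 1.732"
    by (rule real_le_rsqrt) (simp add: power2_eq_square)
  have "1.31 < ln (3.732::real)"
    using ln_approx_bounds[of "3.732" 4] by (simp add: eval_nat_numeral)
  also have "\<dots> \<le> ln (2 + sqrt 3)"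
    using s by simp
  finally show ?thesis .
qed

text \<open>Integrating \<open>arctan x \<ge> x - x^3 / 3\<close> with \<open>x = s * y\<close>,
  after division by \<open>s\<close>, gives the lower bound \<open>y - y^3 / 9\<close>, which is
  sharp enough because \<open>y\<close> is small.\<close>

lemma Im_Li2_two_minus_sqrt3_gt: "Im (Li2 (of_real (2 - sqrt 3) * \<i>)) > 0.265"
proof -
  define y where "y = 2 - sqrt 3"
  have "sqrt 3 \<le> 1.7321" "sqrt 3 < 2"
    by (rule real_le_lsqrt real_less_lsqrt; simp add: power2_eq_square)+
  moreover have "sqrt 3 \<ge> 1.732"
    by (rule real_le_rsqrt) (simp add: power2_eq_square)
  ultimately have y: "y \<ge> 0.2679" "y \<le> 0.268"
    by (auto simp: y_def)
  have "((\<lambda>s. arctan (s * y) / s) has_integral Im (Li2 (of_real y * \<i>))) {0..1}"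
    using has_integral_Im_Li2[of "of_real y * \<i>"] y by simp
  \<comment> \<open>The value at 0 is replaced by the limit \<open>y\<close>, so that the pointwise
    comparison holds there too; division by zero would give 0.\<close>
  then have A: "((\<lambda>s. if s = 0 then y else arctan (s * y) / s) has_integral Im (Li2 (of_real y * \<i>))) {0..1}"
    by (rule has_integral_spike_finite[of "{0}", rotated 2]) auto
  have B: "((\<lambda>s. y - s^2 * y^3 / 3) has_integral ((1 * y - 1^3 * y^3 / 9) - (0 * y - 0^3 * y^3/9))) {0..1}"
    by (rule fundamental_theorem_of_calculus)
      (auto intro!: derivative_eq_intros simp flip: has_real_derivative_iff_has_vector_derivative)
  have "(1 * y - 1^3 * y^3 / 9) - (0 * y - 0^3 * y^3/9) \<le> Im (Li2 (of_real y * \<i>))"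
  proof (rule has_integral_le[OF B A])
    fix s :: real assume s: "s \<in> {0..1}"
    show "y - s^2 * y^3 / 3 \<le> (if s = 0 then y else arctan (s * y) / s)"
    proof (cases "s = 0")
      case False
      with s have s: "0 < s" "s \<le> 1" by auto
      have "s * y \<le> 1 * 0.268"
        using s y by (intro mult_mono) auto
      then have "s * y - (s * y)^3 / 3 \<le> arctan (s * y)"
        using arctan_bounds[of "s * y" 1] s y by (simp add: eval_nat_numeral)
      then show ?thesis
        using s by (simp add: field_simps eval_nat_numeral)
    qed simp
  qed
  moreover have "y^3 \<le> 0.268^3"
    using y by (intro power_mono) auto
  ultimately show ?thesis
    using y unfolding y_def[symmetric] by (simp add: eval_nat_numeral)
qed

text \<open>On the unit circle the logarithmic term of \<open>BlochWigner\<close> vanishes, leaving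
  an \<open>arctan\<close> integral. The \<open>arctan\<close> is bounded by a polynomial
  \<open>q\<close> by comparing derivatives, and \<open>q s / s\<close> is integrated
  termwise.\<close>

lemma v_tet_less: "v_tet < 1.0251"
proof -
  define c where "c = sqrt 3 / 2"
  have c: "c > 0" "c \<le> 0.86605" "c\<^sup>2 = 3 / 4"
  proof -
    have "sqrt 3 \<le> 1.7321"
      by (rule real_le_lsqrt; simp add: power2_eq_square)
    then show "c > 0" "c \<le> 0.86605" "c\<^sup>2 = 3 / 4" by (auto simp: c_def power_divide)
  qed
  define w where "w = cis (pi / 3)"
  have w: "Re w = 1 / 2" "Im w = c" "w \<noteq> 0" "cmod w = 1"
    by (auto simp: w_def c_def cos_60 sin_60 cis_neq_zero)
  have v: "v_tet = Im (Li2 w)"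
    using w(4) by (simp add: v_tet_def BlochWigner_def flip: w_def)
  \<comment> \<open>\<open>q\<close> integrates the bound \<open>c / (1 - x + x\<^sup>2) = c (1 + x) / (1 + x\<^sup>3) \<le> c (1 + x) (1 - x\<^sup>3 + x\<^sup>6)\<close>.\<close>
  define q where "q = (\<lambda>s::real. c * (s + s^2/2 - s^4/4 - s^5/5 + s^7/7 + s^8/8))"
  have bound: "arctan (s * c / (1 - s / 2)) \<le> q s" if s: "s \<in> {0..1}" for s
  proof -
    have "q 0 - arctan (0 * c / (1 - 0 / 2)) \<le> q s - arctan (s * c / (1 - s / 2))"
    proof (rule DERIV_nonneg_imp_nondecreasing[where a = 0 and b = s
          and f = "\<lambda>x. q x - arctan (x * c / (1 - x / 2))"])
      show "0 \<le> s" using s by simp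
      fix x assume x: "0 \<le> x" "x \<le> s"
      with s have x1: "x \<le> 1" by simp
      define d where "d = c * (1 + x) * (1 - x^3 + x^6) - c / (1 - x + x\<^sup>2)"
      have pos: "1 - x + x\<^sup>2 > 0"
        using x x1 by (cases "x = 1") (auto simp: add_pos_nonneg)
      have D1: "((\<lambda>x. x * c / (1 - x / 2)) has_field_derivative c / (1 - x / 2)\<^sup>2) (at x)"
        using x1 by (auto intro!: derivative_eq_intros simp: field_simps power2_eq_square)
      have D2: "(q has_field_derivative c * (1 + x) * (1 - x^3 + x^6)) (at x)"
        unfolding q_def by (auto intro!: derivative_eq_intros simp: algebra_simps eval_nat_numeral)
      \<comment> \<open>Since \<open>c\<^sup>2 = 3 / 4\<close>, the sum
        \<open>(1 - x / 2)\<^sup>2 + (x * c)\<^sup>2\<close> equals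
        \<open>1 - x + x\<^sup>2\<close>.\<close>
      have "inverse (1 + (x * c / (1 - x / 2))\<^sup>2) * (c / (1 - x / 2)\<^sup>2) = c / (1 - x + x\<^sup>2)"
      proof -
        have "1 + (x * c / (1 - x / 2))\<^sup>2 = (1 - x + x\<^sup>2) / (1 - x / 2)\<^sup>2"
          using x1 by (simp add: power_divide power_mult_distrib c(3) field_simps) (simp add: power2_eq_square field_simps)
        then show ?thesis using x1 pos by simp
      qed
      then have "((\<lambda>x. q x - arctan (x * c / (1 - x / 2))) has_field_derivative d) (at x)"
        using DERIV_diff[OF D2 DERIV_chain2[OF DERIV_arctan D1]] by (simp add: d_def)
      moreover have "d \<ge> 0"
      proof -
        \<comment> \<open>Two sums of cubes: \<open>(1 + x) * (1 - x + x\<^sup>2) = 1 + x^3\<close>,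
          and \<open>(1 + x^3) * (1 - x^3 + x^6) = 1 + x^9\<close>, which is at least 1
          here.\<close>
        have "(1 + x) * (1 - x^3 + x^6) * (1 - x + x\<^sup>2) = 1 + x^9"
          by (simp add: algebra_simps eval_nat_numeral)
        then have "1 / (1 - x + x\<^sup>2) \<le> (1 + x) * (1 - x^3 + x^6)"
          using x pos by (simp add: pos_divide_le_eq)
        then have "c * (1 / (1 - x + x\<^sup>2)) \<le> c * ((1 + x) * (1 - x^3 + x^6))"
          using c by (intro mult_left_mono) auto
        then show ?thesis by (simp add: d_def mult.assoc)
      qed
      ultimately show "\<exists>y. ((\<lambda>x. q x - arctan (x * c / (1 - x / 2))) has_field_derivative y) (at x) \<and> 0 \<le> y"
        by blast
    qed
    then show ?thesis by (simp add: q_def)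
  qed
  have "((\<lambda>s. arctan (s * c / (1 - s / 2)) / s) has_integral Im (Li2 w)) {0..1}"
    using has_integral_Im_Li2[of w] w by simp
  then have A: "((\<lambda>s. if s = 0 then c else arctan (s * c / (1 - s / 2)) / s) has_integral Im (Li2 w)) {0..1}"
    by (rule has_integral_spike_finite[of "{0}", rotated 2]) auto
  define Q where "Q = (\<lambda>s::real. c * (s + s^2/4 - s^4/16 - s^5/25 + s^7/49 + s^8/64))"
  have B: "((\<lambda>s. c * (1 + s/2 - s^3/4 - s^4/5 + s^6/7 + s^7/8)) has_integral (Q 1 - Q 0)) {0..1}"
    unfolding Q_def
    by (rule fundamental_theorem_of_calculus)
      (auto intro!: derivative_eq_intros simp: field_simps simp flip: has_real_derivative_iff_has_vector_derivative)
  have "Im (Li2 w) \<le> Q 1 - Q 0"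
  proof (rule has_integral_le[OF A B])
    fix s :: real assume s: "s \<in> {0..1}"
    show "(if s = 0 then c else arctan (s * c / (1 - s / 2)) / s) \<le> c * (1 + s/2 - s^3/4 - s^4/5 + s^6/7 + s^7/8)"
    proof (cases "s = 0")
      case False
      have "q s = c * (1 + s/2 - s^3/4 - s^4/5 + s^6/7 + s^7/8) * s"
        by (simp add: q_def algebra_simps eval_nat_numeral)
      with False s bound[OF s] show ?thesis
        by (simp add: pos_divide_le_eq)
    qed simp
  qed
  also have "Q 1 - Q 0 < 1.0251"
    using c by (simp add: Q_def)
  finally show ?thesis
    unfolding v .
qed

section \<open>The Mahler measure of \<open>p_C0\<close>\<close>

text \<open>Both quadratics in \<open>w\<close> are palindromic: on the unit circle
  \<open>w\<^sup>2 + 1\<close> is \<open>2 * cos t * w\<close>, so a factor \<open>w\<close> of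
  modulus 1 splits off.\<close>

lemma cmod_p_C0_cis:
  "cmod (p_C0 (cis s) (cis t)) =
    (cmod (of_real (4 - 2 * cos t) * cis s + of_real (4 + 2 * cos t)))\<^sup>2"
proof -
  have sq: "(cis t)\<^sup>2 + 1 = of_real (2 * cos t) * cis t"
    using cos_squared_eq[of t] by (auto simp: complex_eq_iff power2_eq_square cos_squared_eq)
  have "- cis s * ((cis t)\<^sup>2 - 4 * cis t + 1) + (cis t)\<^sup>2 + 4 * cis t + 1
      = - cis s * (((cis t)\<^sup>2 + 1) - 4 * cis t) + ((cis t)\<^sup>2 + 1) + 4 * cis t"
    by (simp add: algebra_simps)
  also have "\<dots> = (of_real (4 - 2 * cos t) * cis s + of_real (4 + 2 * cos t)) * cis t"
    unfolding sq by (simp add: algebra_simps)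
  finally show ?thesis
    by (simp only: p_C0_def norm_power norm_mult norm_cis mult_1_right)
qed

text \<open>Where \<open>cos t = 0\<close> the two coefficients have equal modulus and the Jensen
  lemma above does not apply; these \<open>t\<close> form a countable set.\<close>

lemma AE_cos_nonzero: "AE t :: real in lborel. cos t \<noteq> 0"
proof -
  have "{t :: real. cos t = 0} \<subseteq> range (\<lambda>n::int. n * pi + pi / 2)"
    by (auto simp: cos_zero_iff_int2)
  then have "countable {t :: real. cos t = 0}"
    by (rule countable_subset) auto
  from AE_not_in[OF countable_imp_null_set_lborel[OF this]] show ?thesis
    by simp
qed

lemma mahler2_p_C0:
  assumes I: "((\<lambda>t. ln (4 + 2 * cos t)) has_integral I) {0..pi/2}"
  shows "2 * pi * mahler2 p_C0 = 8 * I"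
proof -
  define f where "f = (\<lambda>x :: real \<times> real. ln (cmod (p_C0 (cis (fst x)) (cis (snd x)))))"
  \<comment> \<open>The inner integral: \<open>2 * pi\<close> from Jensen's formula, and a further 2
    from the square in \<open>p_C0\<close>.\<close>
  define g where "g = (\<lambda>t. 4 * pi * ln (4 + 2 * \<bar>cos t\<bar>))"
  define a where "a = (\<lambda>t. complex_of_real (4 - 2 * cos t))"
  define b where "b = (\<lambda>t. complex_of_real (4 + 2 * cos t))"
  have ab: "cmod (a t) = 4 - 2 * cos t" "cmod (b t) = 4 + 2 * cos t" for t
    unfolding a_def b_def norm_of_real using cos_ge_minus_one[of t] cos_le_one[of t] by linarith+
  have f: "f (s, t) = 2 * ln (cmod (a t * cis s + b t))" for s t
    by (simp add: f_def cmod_p_C0_cis a_def b_def ln_realpow)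
  have cont_g: "continuous_on {0..2*pi} g"
    unfolding g_def by (intro continuous_intros) (auto simp: add_nonneg_eq_0_iff)
  have "(LINT x : ({0..2*pi} \<times> {0..2*pi}) | lborel. f x) = (LINT t:{0..2*pi}|lborel. g t)"
  proof (rule set_lebesgue_integral_Times_iterated)
    show "f \<in> borel_measurable borel"
    proof -
      have "continuous_on UNIV (\<lambda>x. cmod (p_C0 (cis (fst x)) (cis (snd x))))"
        unfolding p_C0_def by (intro continuous_intros)
      then show ?thesis
        unfolding f_def by (intro borel_measurable_ln borel_measurable_continuous_onI)
    qed
    show "f (s, t) \<le> 2 * ln 8" for s t
    proof -
      have "cmod (a t * cis s + b t) \<le> cmod (a t * cis s) + cmod (b t)"
        by (rule norm_triangle_ineq)
      also have "\<dots> = 8"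
        by (simp add: norm_mult ab)
      finally have "cmod (a t * cis s + b t) \<le> 8" .
      then show ?thesis
        \<comment> \<open>At a zero of the polynomial the convention \<open>ln 0 = 0\<close> keeps
          the upper bound valid.\<close>
        unfolding f by (cases "a t * cis s + b t = 0") auto
    qed
    show "AE t in lborel. t \<in> {0..2*pi} \<longrightarrow>
        set_integrable lborel {0..2*pi} (\<lambda>s. f (s, t)) \<and> (LINT s:{0..2*pi}|lborel. f (s, t)) = g t"
      using AE_cos_nonzero
    proof eventually_elim
      case (elim t)
      then have ne: "cmod (a t) \<noteq> cmod (b t)"
        by (simp add: ab)
      \<comment> \<open>Without zeros the integrand is continuous in \<open>s\<close>, so its
        Lebesgue and gauge integrals agree.\<close>
      have "a t * cis s + b t \<noteq> 0" for s
      proof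
        assume "a t * cis s + b t = 0"
        then have "cmod (a t * cis s) = cmod (b t)"
          by (metis add_eq_0_iff norm_minus_cancel)
        with ne show False by (simp add: norm_mult)
      qed
      then have "continuous_on {0..2*pi} (\<lambda>s. f (s, t))"
        unfolding f by (intro continuous_intros) auto
      then have si: "set_integrable lborel {0..2*pi} (\<lambda>s. f (s, t))"
        by (rule borel_integrable_atLeastAtMost')
      have "((\<lambda>s. f (s, t)) has_integral 2 * (2 * pi * ln (max (cmod (a t)) (cmod (b t))))) {0..2*pi}"
        unfolding f by (intro has_integral_mult_right has_integral_ln_cmod_linear_cis ne)
      moreover have "max (cmod (a t)) (cmod (b t)) = 4 + 2 * \<bar>cos t\<bar>"
        by (auto simp: ab max_def abs_if)
      ultimately have "integral {0..2*pi} (\<lambda>s. f (s, t)) = g t"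
        by (simp add: g_def integral_unique)
      with si show ?case
        by (simp add: set_borel_integral_eq_integral)
    qed
    show "set_integrable lborel {0..2*pi} g"
      by (rule borel_integrable_atLeastAtMost'[OF cont_g])
  qed auto
  also have "\<dots> = integral {0..2*pi} g"
    by (intro set_borel_integral_eq_integral borel_integrable_atLeastAtMost' cont_g)
  also have "\<dots> = 4 * pi * (4 * I)"
    unfolding g_def
    by (intro integral_unique has_integral_mult_right has_integral_abs_cos_period[of "\<lambda>x. ln (4 + 2 * x)"] I)
  finally show ?thesis
    unfolding mahler2_def f_def by (simp add: power2_eq_square)
qed

theorem theorem4p4:
  shows "2 * pi * mahler2 p_C0 =
           16 * BlochWigner (complex_of_real (2 + sqrt 3) * \<i>) + (8 * pi / 3) * ln (2 + sqrt 3)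
         \<and> 20 * v_tet < 2 * pi * mahler2 p_C0"
proof
  have roots: "2 + sqrt 3 > 0" "1 + (2 + sqrt 3)\<^sup>2 = 4 * (2 + sqrt 3)"
    "2 - sqrt 3 > 0" "1 + (2 - sqrt 3)\<^sup>2 = 4 * (2 - sqrt 3)"
    by (auto simp: power2_eq_square algebra_simps add_pos_nonneg intro: real_less_lsqrt)
  have arg: "Arg (1 - complex_of_real (2 + sqrt 3) * \<i>) = - (5 * pi / 12)"
    by (subst arg_conv_arctan) (use arctan_minus[of "2 + sqrt 3"] in \<open>auto simp: arctan_two_plus_sqrt3\<close>)
  have "cmod (complex_of_real (2 + sqrt 3) * \<i>) = 2 + sqrt 3"
    using roots(1) unfolding norm_mult norm_of_real by simp
  then have "BlochWigner (complex_of_real (2 + sqrt 3) * \<i>) =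
      Im (Li2 (complex_of_real (2 + sqrt 3) * \<i>)) - 5 * pi / 12 * ln (2 + sqrt 3)"
    unfolding BlochWigner_def arg by simp
  \<comment> \<open>Coefficient of the logarithm:
    \<open>16 * (5 * pi / 12) - 4 * pi = 8 * pi / 3\<close>.\<close>
  then show "2 * pi * mahler2 p_C0 =
      16 * BlochWigner (complex_of_real (2 + sqrt 3) * \<i>) + (8 * pi / 3) * ln (2 + sqrt 3)"
    unfolding mahler2_p_C0[OF has_integral_ln_four_plus_cos[OF roots(1,2)]] by argo
  have "ln (2 - sqrt 3) = - ln (2 + sqrt 3)"
  proof -
    have "2 - sqrt 3 = inverse (2 + sqrt 3)"
      using roots(1) by (intro inverse_unique[symmetric]) (simp add: algebra_simps)
    then show ?thesis by (simp add: ln_inverse)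
  qed
  moreover have "pi * ln (2 + sqrt 3) \<ge> 3.14 * 1.31"
    using pi_approx(1) ln_two_plus_sqrt3_gt by (intro mult_mono) auto
  \<comment> \<open>The right side is at least
    \<open>16 * 0.265 + 4 * 3.14 * 1.31 = 20.6936\<close>, the left side below
    \<open>20 * 1.0251 = 20.502\<close>.\<close>
  ultimately show "20 * v_tet < 2 * pi * mahler2 p_C0"
    unfolding mahler2_p_C0[OF has_integral_ln_four_plus_cos[OF roots(3,4)]]
    using Im_Li2_two_minus_sqrt3_gt v_tet_less by simp
qed

end
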